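(* Let $n\ge2$, $\gamma\in\mathbb{R}$ and $n<p<+\infty$. There exists a constant $C=C(n,\gamma,p)>0$ such that, for every $u\in C^\infty_c(\mathbb{R}^n_+)$ and every $x,y\in\mathbb{R}^n_+$, \[ |u(x)-u(y)|\le C\,\Theta^0_{1-\frac np,\,1-\frac{n+\gamma}{p}}(x,y)\Big(\int_{\mathbb{R}^n_+}|Du(z)|^pz_n^\gamma\,dz\Big)^{1/p}. \] Explicitly: if $\gamma>p-n$ the factor is $\frac{|x-y|^{1-\frac np}}{\min(x_n,y_n)^{\frac{n+\gamma}{p}-1}\max(x_n,y_n,|x-y|)^{1-\frac np}}$, and if $\gamma\le p-n$ it is $\frac{\max(x_n,y_n)^{1-\frac{n+\gamma}{p}}|x-y|^{1-\frac np}}{\max(x_n,y_n,|x-y|)^{1-\frac np}}$.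
   Context: $\mathbb{R}^n_+=\mathbb{R}^{n-1}\times(0,+\infty)$, points written $x=(x',x_n)$; $C^\infty_c(\mathbb{R}^n_+)$ are smooth functions with compact support contained in the open half-space. For $\beta,\kappa\in\mathbb{R}$: $\Theta^0_{\beta,\kappa}(x,y)=\frac{|x-y|^\beta}{\min(x_n,y_n)^{-\kappa}\max(x_n,y_n,|x-y|)^\beta}$ if $\kappa<0$, and $\Theta^0_{\beta,\kappa}(x,y)=\frac{\max(x_n,y_n)^\kappa|x-y|^\beta}{\max(x_n,y_n,|x-y|)^\beta}$ if $\kappa\ge0$. *)

theory Defs
  imports "HOL-Analysis.Analysis"
begin

text \<open>Points of R^n are modelled as pairs (x', x_n) in (real^'m) \<times> real, with n = CARD('m) + 1.
  The product norm is Euclidean.\<close>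

definition upper_half :: "((real^'m) \<times> real) set" where
  "upper_half = {x. snd x > 0}"

coinductive smooth_fun :: "('a::euclidean_space \<Rightarrow> real) \<Rightarrow> bool" where
  "(\<forall>x. f differentiable (at x)) \<Longrightarrow> (\<forall>v. smooth_fun (\<lambda>x. frechet_derivative f (at x) v))
     \<Longrightarrow> smooth_fun f"

definition Cc_inf_half :: "((real^'m) \<times> real \<Rightarrow> real) set" where
  "Cc_inf_half = {u. smooth_fun u \<and> compact (closure {x. u x \<noteq> 0})
                     \<and> closure {x. u x \<noteq> 0} \<subseteq> upper_half}"

definition Theta0 :: "real \<Rightarrow> real \<Rightarrow> (real^'m) \<times> real \<Rightarrow> (real^'m) \<times> real \<Rightarrow> real" where
  "Theta0 \<beta> \<kappa> x y =
     (if \<kappa> < 0 then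
        dist x y powr \<beta> /
          (min (snd x) (snd y) powr (-\<kappa>) * max (max (snd x) (snd y)) (dist x y) powr \<beta>)
      else
        max (snd x) (snd y) powr \<kappa> * dist x y powr \<beta> /
          max (max (snd x) (snd y)) (dist x y) powr \<beta>)"

end

(* Everything follows from one integral estimate over a cone with apex a = (a', h): the segments
   from a to the points of a horizontal ball, together with the fundamental theorem of calculus and
   a weighted Hoelder inequality (a pointwise inequality, optimised over a scaling parameter), bound
   the mean of |u(end) - u(a)| by the weighted energy.
   For two points that are close relative to their height, two cones over a common base give
   Morrey's estimate. For points that are far apart, each of |u(x)|, |u(y)| is bounded separately,
   with a cone whose base lies outside the support of u: a downward cone reaching the boundary if
   gamma < p - 1, and an upward cone going to infinity if gamma > p - n. Since n >= 2, these two
   ranges cover all gamma; in particular the critical case gamma = p - n is not special. *)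
theory Submission
  imports Defs
begin

section \<open>Regularity of test functions and vanishing off the support\<close>

lemma smooth_fun_differentiable: "smooth_fun f \<Longrightarrow> f differentiable (at x)"
  by (auto elim: smooth_fun.cases)

lemma smooth_fun_frechet_derivative:
  "smooth_fun f \<Longrightarrow> smooth_fun (\<lambda>x. frechet_derivative f (at x) v)"
  by (auto elim: smooth_fun.cases)

text \<open>The linear maps act on a finite-dimensional space, so continuity at each fixed vector
  already gives continuity in operator norm; \<open>Blinfun\<close> moves the family into the normed
  space where this can be expressed.\<close>

lemma continuous_on_onorm:
  fixes D :: "'a::topological_space \<Rightarrow> 'b::euclidean_space \<Rightarrow> 'c::real_normed_vector"
  assumes bl: "\<And>x. bounded_linear (D x)"
    and cont: "\<And>v. continuous_on S (\<lambda>x. D x v)"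
  shows "continuous_on S (\<lambda>x. onorm (D x))"
proof -
  have "continuous_on S (\<lambda>x. Blinfun (D x))"
    unfolding continuous_on_def
  proof (intro ballI tendsto_componentwise1)
    show "((\<lambda>x. blinfun_apply (Blinfun (D x)) j) \<longlongrightarrow> blinfun_apply (Blinfun (D x)) j) (at x within S)"
      if "x \<in> S" for x j
      using cont[of j] that by (simp add: bounded_linear_Blinfun_apply bl continuous_on_def)
  qed
  then have "continuous_on S (\<lambda>x. norm (Blinfun (D x)))"
    by (rule continuous_on_norm)
  then show ?thesis
    by (simp add: norm_blinfun.rep_eq bounded_linear_Blinfun_apply bl)
qed

lemma smooth_fun_continuous_onorm:
  assumes "smooth_fun f"
  shows "continuous_on UNIV (\<lambda>x. onorm (frechet_derivative f (at x)))"
proof (rule continuous_on_onorm)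
  show "bounded_linear (frechet_derivative f (at x))" for x
    using smooth_fun_differentiable[OF assms] frechet_derivative_works has_derivative_bounded_linear
    by blast
  show "continuous_on UNIV (\<lambda>x. frechet_derivative f (at x) v)" for v
    using smooth_fun_differentiable[OF smooth_fun_frechet_derivative[OF assms]]
    by (metis differentiable_at_imp_differentiable_on differentiable_imp_continuous_on)
qed

text \<open>The complement of the support is open, so near such a point \<open>u\<close> coincides
  with the constant 0 and shares its derivative.\<close>

lemma Cc_inf_half_zero_outside:
  assumes "u \<in> Cc_inf_half" "x \<notin> closure {z. u z \<noteq> 0}"
  shows "u x = 0" "onorm (frechet_derivative u (at x)) = 0"
proof -
  let ?S = "closure {z. u z \<noteq> 0}"
  have zero: "u z = 0" if "z \<notin> ?S" for z
    using that closure_subset[of "{z. u z \<noteq> 0}"] by (meson mem_Collect_eq subsetD)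
  show "u x = 0"
    by (rule zero) fact
  have "((\<lambda>_. 0) has_derivative (\<lambda>_. 0)) (at x)"
    by simp
  then have "(u has_derivative (\<lambda>_. 0)) (at x)"
  proof (rule has_derivative_transform_within_open[where s = "- ?S"])
    show "0 = u z" if "z \<in> - ?S" for z
      using that zero[of z] by simp
  qed (use assms(2) in auto)
  then have "frechet_derivative u (at x) = (\<lambda>_. 0)"
    using frechet_derivative_at by metis
  then show "onorm (frechet_derivative u (at x)) = 0"
    by (simp add: onorm_zero)
qed

text \<open>Members of \<open>Cc_inf_half\<close> are defined on the whole space; this supplies the
  zero boundary value at which a downward cone ends.\<close>

lemma Cc_inf_half_zero_outside_upper_half:
  assumes "u \<in> Cc_inf_half" "snd x \<le> 0"
  shows "u x = 0"
proof -
  have "x \<notin> closure {z. u z \<noteq> 0}"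
    using assms unfolding Cc_inf_half_def upper_half_def
    by (metis (mono_tags, lifting) mem_Collect_eq not_le subsetD)
  then show ?thesis
    by (rule Cc_inf_half_zero_outside[OF assms(1)])
qed

text \<open>On the compact support the height is positive, hence the weight is continuous for every
  real \<gamma>; off the support the derivative is 0. Without integrability the Bochner integral
  would default to 0 and would not measure the energy.\<close>

lemma energy_integrable:
  fixes u :: "(real^'m) \<times> real \<Rightarrow> real"
  assumes u: "u \<in> Cc_inf_half" and p: "p > 0"
  shows "set_integrable lborel upper_half
           (\<lambda>z. onorm (frechet_derivative u (at z)) powr p * snd z powr \<gamma>)"
proof -
  let ?S = "closure {z. u z \<noteq> 0}"
  let ?g = "\<lambda>z. onorm (frechet_derivative u (at z)) powr p * snd z powr \<gamma>"
  have smooth: "smooth_fun u" and S: "compact ?S" "?S \<subseteq> upper_half"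
    using u by (auto simp: Cc_inf_half_def)
  have bl: "bounded_linear (frechet_derivative u (at z))" for z
    using smooth_fun_differentiable[OF smooth] frechet_derivative_works
      has_derivative_bounded_linear by blast
  have "continuous_on ?S (\<lambda>z. onorm (frechet_derivative u (at z)))"
    using smooth_fun_continuous_onorm[OF smooth] continuous_on_subset by blast
  \<comment> \<open>Zeros of the derivative are harmless because \<open>p > 0\<close>; the weight
    needs positive heights, which the support guarantees.\<close>
  then have "continuous_on ?S ?g"
    using S p onorm_pos_le[OF bl]
    by (intro continuous_on_mult continuous_on_powr' continuous_intros)
       (force simp: upper_half_def)+
  then have "integrable lborel (\<lambda>z. indicator ?S z *\<^sub>R ?g z)"
    by (rule borel_integrable_compact[OF S(1)])
  also have "(\<lambda>z. indicator ?S z *\<^sub>R ?g z) = (\<lambda>z. indicator upper_half z *\<^sub>R ?g z)"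
  proof
    fix z :: "(real^'m) \<times> real"
    consider "z \<in> ?S" | "z \<notin> ?S" by blast
    then show "indicator ?S z *\<^sub>R ?g z = indicator upper_half z *\<^sub>R ?g z"
    proof cases
      case 1 then show ?thesis using S by (auto simp: indicator_def)
    next
      case 2 then show ?thesis using Cc_inf_half_zero_outside(2)[OF u 2] by simp
    qed
  qed
  finally show ?thesis by (simp add: set_integrable_def)
qed

section \<open>Increments along segments and integration over cones\<close>

text \<open>The fundamental theorem of calculus, phrased in \<open>ennreal\<close> so that Tonelli
  applies later with no integrability conditions. The interval is open because the height along a
  cone may reach 0 at the end.\<close>

lemma segment_increment_le:
  fixes u :: "'a::euclidean_space \<Rightarrow> real"
  assumes u: "smooth_fun u" and T: "0 \<le> T"
  shows "ennreal \<bar>u (a + T *\<^sub>R v) - u a\<bar> \<le>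
    (\<integral>\<^sup>+s. ennreal (onorm (frechet_derivative u (at (a + s *\<^sub>R v))) * norm v) * indicator {0<..<T} s \<partial>lborel)"
proof -
  let ?D = "\<lambda>s. frechet_derivative u (at (a + s *\<^sub>R v))"
  let ?g = "\<lambda>s. onorm (?D s) * norm v"
  have der: "(u has_derivative frechet_derivative u (at z)) (at z)" for z
    using smooth_fun_differentiable[OF u] frechet_derivative_works by blast
  have bl: "bounded_linear (frechet_derivative u (at z))" for z
    using der has_derivative_bounded_linear by blast
  have "((\<lambda>s. u (a + s *\<^sub>R v)) has_vector_derivative ?D s v) (at s within {0..T})" for s
  proof -
    have "((\<lambda>s. a + s *\<^sub>R v) has_derivative (\<lambda>h. h *\<^sub>R v)) (at s within {0..T})"
      by (auto intro!: derivative_eq_intros)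
    then have "((\<lambda>s. u (a + s *\<^sub>R v)) has_derivative (\<lambda>h. ?D s (h *\<^sub>R v))) (at s within {0..T})"
      using has_derivative_compose der by blast
    moreover have "(\<lambda>h. ?D s (h *\<^sub>R v)) = (\<lambda>h. h *\<^sub>R ?D s v)"
      using bl by (simp add: bounded_linear.linear linear_scale)
    ultimately show ?thesis
      by (simp add: has_vector_derivative_def)
  qed
  then have ftc: "((\<lambda>s. ?D s v) has_integral u (a + T *\<^sub>R v) - u (a + 0 *\<^sub>R v)) {0..T}"
    by (intro fundamental_theorem_of_calculus T)
  have "continuous_on {0..T} ((\<lambda>z. onorm (frechet_derivative u (at z))) \<circ> (\<lambda>s. a + s *\<^sub>R v))"
    by (intro continuous_on_compose continuous_intros
        continuous_on_subset[OF smooth_fun_continuous_onorm[OF u]]) auto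
  then have "continuous_on {0..T} ?g"
    by (auto simp: o_def intro!: continuous_intros)
  then have gint: "?g integrable_on {0..T}"
    by (rule integrable_continuous_interval)
  have g0: "0 \<le> ?g s" for s
    using onorm_pos_le[OF bl] by simp
  have "norm (integral {0..T} (\<lambda>s. ?D s v)) \<le> integral {0..T} ?g"
    using ftc gint onorm[OF bl] by (intro integral_norm_bound_integral) auto
  then have "\<bar>u (a + T *\<^sub>R v) - u a\<bar> \<le> integral {0..T} ?g"
    using ftc by (simp add: integral_unique)
  then have "ennreal \<bar>u (a + T *\<^sub>R v) - u a\<bar> \<le> ennreal (integral {0..T} ?g)"
    by (rule ennreal_leI)
  also have "\<dots> = (\<integral>\<^sup>+s. ennreal (?g s) * indicator {0<..<T} s \<partial>lborel)"
  proof -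
    have "(?g has_integral integral {0..T} ?g) {0<..<T}"
      using gint by (metis cbox_interval box_real(1) has_integral_open_interval integrable_integral)
    from nn_integral_has_integral_lebesgue'[OF g0 this] show ?thesis by simp
  qed
  finally show ?thesis .
qed

lemma nn_integral_affine_euclidean:
  fixes f :: "'a::euclidean_space \<Rightarrow> ennreal"
  assumes [measurable]: "f \<in> borel_measurable borel" and c: "c \<noteq> 0"
  shows "(\<integral>\<^sup>+x. f x \<partial>lborel) = ennreal (\<bar>c\<bar> ^ DIM('a)) * (\<integral>\<^sup>+x. f (t + c *\<^sub>R x) \<partial>lborel)"
  by (subst lborel_affine[OF c, of t])
     (simp add: nn_integral_density nn_integral_distr nn_integral_cmult)

text \<open>The segments from the apex \<open>a\<close> sweep out a cone, with Jacobian \<open>(s d)^m \<bar>r\<bar>\<close>.\<close>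

lemma cone_nn_integral_le:
  fixes g :: "'a::euclidean_space \<times> real \<Rightarrow> ennreal"
  assumes [measurable]: "g \<in> borel_measurable borel" and d: "d > 0" and r: "r \<noteq> 0"
  shows "(\<integral>\<^sup>+w. (\<integral>\<^sup>+s. g (a + s *\<^sub>R (c + d *\<^sub>R w, r)) * ennreal (s ^ DIM('a)) * indicator {0<..<T} s \<partial>lborel) \<partial>lborel)
    \<le> ennreal (1 / (d ^ DIM('a) * \<bar>r\<bar>)) * (\<integral>\<^sup>+z. g z \<partial>lborel)"
proof -
  let ?m = "DIM('a)"
  \<comment> \<open>At fixed \<open>s\<close> the map from \<open>w\<close> to the slice is a
    homothety of ratio \<open>s * d\<close>; its Jacobian absorbs \<open>s ^ ?m\<close> and leaves
    \<open>1 / d ^ ?m\<close>. Only the restriction on \<open>s\<close> is given up.\<close>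
  have slice: "(\<integral>\<^sup>+w. g (a + s *\<^sub>R (c + d *\<^sub>R w, r)) * ennreal (s ^ ?m) * indicator {0<..<T} s \<partial>lborel)
      \<le> ennreal (1 / d ^ ?m) * (\<integral>\<^sup>+w. g (w, snd a + r * s) \<partial>lborel)" (is "?L \<le> ?R") for s
  proof (cases "s \<in> {0<..<T}")
    case True
    then have s: "s > 0" by simp
    have path: "a + s *\<^sub>R (c + d *\<^sub>R w, r) = ((fst a + s *\<^sub>R c) + (s * d) *\<^sub>R w, snd a + r * s)" for w
      by (cases a) (simp add: algebra_simps)
    have "?L = (\<integral>\<^sup>+w. g ((fst a + s *\<^sub>R c) + (s * d) *\<^sub>R w, snd a + r * s) \<partial>lborel) * ennreal (s ^ ?m)"
      using True by (simp only: path indicator_simps mult_1_right)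
        (rule nn_integral_multc, measurable)
    also have "\<dots> = ennreal (1 / d ^ ?m) * (ennreal (\<bar>s * d\<bar> ^ ?m) *
        (\<integral>\<^sup>+w. g ((fst a + s *\<^sub>R c) + (s * d) *\<^sub>R w, snd a + r * s) \<partial>lborel))"
      using s d by (simp add: mult.assoc[symmetric] ennreal_mult[symmetric] power_mult_distrib mult.commute)
    also have "\<dots> = ?R"
      using s d
      by (subst nn_integral_affine_euclidean[of "\<lambda>w. g (w, snd a + r * s)" "s * d" "fst a + s *\<^sub>R c"]) auto
    finally show ?thesis by simp
  qed simp
  have "(\<integral>\<^sup>+w. (\<integral>\<^sup>+s. g (a + s *\<^sub>R (c + d *\<^sub>R w, r)) * ennreal (s ^ ?m) * indicator {0<..<T} s \<partial>lborel) \<partial>lborel)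
      = (\<integral>\<^sup>+s. (\<integral>\<^sup>+w. g (a + s *\<^sub>R (c + d *\<^sub>R w, r)) * ennreal (s ^ ?m) * indicator {0<..<T} s \<partial>lborel) \<partial>lborel)"
    by (rule lborel_pair.Fubini'[symmetric]) (simp add: split_beta)
  also have "\<dots> \<le> (\<integral>\<^sup>+s. ennreal (1 / d ^ ?m) * (\<integral>\<^sup>+w. g (w, snd a + r * s) \<partial>lborel) \<partial>lborel)"
    by (rule nn_integral_mono) (rule slice)
  also have "\<dots> = ennreal (1 / d ^ ?m) * (\<integral>\<^sup>+s. (\<integral>\<^sup>+w. g (w, snd a + r * s) \<partial>lborel) \<partial>lborel)"
    by (rule nn_integral_cmult) measurable
  also have "(\<integral>\<^sup>+s. (\<integral>\<^sup>+w. g (w, snd a + r * s) \<partial>lborel) \<partial>lborel)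
      = ennreal (1 / \<bar>r\<bar>) * (ennreal \<bar>r\<bar> * (\<integral>\<^sup>+s. (\<integral>\<^sup>+w. g (w, snd a + r * s) \<partial>lborel) \<partial>lborel))"
    using r by (simp add: mult.assoc[symmetric] ennreal_mult[symmetric])
  \<comment> \<open>The slices are now indexed by their height \<open>snd a + r * s\<close> instead
    of \<open>s\<close>; this substitution is the origin of the factor 1/|r|.\<close>
  also have "ennreal \<bar>r\<bar> * (\<integral>\<^sup>+s. (\<integral>\<^sup>+w. g (w, snd a + r * s) \<partial>lborel) \<partial>lborel)
      = (\<integral>\<^sup>+h. (\<integral>\<^sup>+w. g (w, h) \<partial>lborel) \<partial>lborel)"
    by (rule nn_integral_real_affine[symmetric, OF _ r]) measurable
  also have "\<dots> = (\<integral>\<^sup>+z. g z \<partial>(lborel \<Otimes>\<^sub>M lborel))"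
    by (rule lborel_pair.nn_integral_snd) (simp add: lborel_prod)
  also have "\<dots> = (\<integral>\<^sup>+z. g z \<partial>lborel)"
    by (simp add: lborel_prod)
  finally show ?thesis
    using d r by (simp add: mult.assoc[symmetric] ennreal_mult[symmetric])
qed

section \<open>The weighted energy and a Hoelder inequality by scaling\<close>

definition weighted_energy :: "real \<Rightarrow> real \<Rightarrow> ((real^'m) \<times> real \<Rightarrow> real) \<Rightarrow> real" where
  "weighted_energy p \<gamma> u =
     (\<integral>z\<in>upper_half. onorm (frechet_derivative u (at z)) powr p * snd z powr \<gamma> \<partial>lborel)"

lemma weighted_energy_nonneg: "weighted_energy p \<gamma> u \<ge> 0"
  unfolding weighted_energy_def set_lebesgue_integral_def
  by (rule integral_nonneg_AE) simp

text \<open>A Young inequality without sharp constants: if \<open>\<kappa> * F powr (p - 1)\<close>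
  is at least 1, the first term alone dominates \<open>F\<close>; otherwise the second does. The
  factor \<kappa> will carry the Jacobian and the weight.\<close>

lemma weighted_young:
  fixes F :: real
  assumes "F \<ge> 0" "\<kappa> > 0" "p > 1"
  shows "F \<le> \<kappa> * F powr p + \<kappa> powr (- 1 / (p - 1))"
proof (cases "F = 0 \<or> 1 \<le> \<kappa> * F powr (p - 1)")
  case True
  have "F \<le> \<kappa> * F powr p" if "F \<noteq> 0"
  proof -
    have "F * 1 \<le> F * (\<kappa> * F powr (p - 1))"
      using assms True that by (intro mult_left_mono) auto
    also have "\<dots> = \<kappa> * (F * F powr (p - 1))"
      by simp
    also have "F * F powr (p - 1) = F powr p"
      using assms that by (simp add: powr_mult_base)
    finally show ?thesis by simp
  qed
  then have "F \<le> \<kappa> * F powr p"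
    using assms by (cases "F = 0") auto
  then show ?thesis by (simp add: add_increasing2)
next
  case False
  then have "F powr (p - 1) \<le> 1 / \<kappa>"
    using assms by (simp add: field_simps)
  then have "(F powr (p - 1)) powr (1 / (p - 1)) \<le> (1 / \<kappa>) powr (1 / (p - 1))"
    using assms by (intro powr_mono2) auto
  then have "F \<le> \<kappa> powr (- 1 / (p - 1))"
    using assms False by (simp add: powr_powr powr_divide powr_minus_divide)
  moreover have "0 \<le> \<kappa> * F powr p"
    using assms by simp
  ultimately show ?thesis by linarith
qed

text \<open>Minimising over the scale turns a family of Young bounds into a Hoelder bound, with
  \<open>P\<close> in the role of the energy and \<open>R\<close> in that of the integral of the
  dual weight.\<close>

lemma optimize_scaling:
  fixes x :: real
  assumes le: "\<And>\<mu>. \<mu> > 0 \<Longrightarrow> x \<le> \<mu> * P + \<mu> powr (- 1 / (p - 1)) * R"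
    and P: "P \<ge> 0" and R: "R > 0" and p: "p > 1"
  shows "x \<le> 2 * P powr (1 / p) * R powr (1 - 1 / p)"
proof (cases "P = 0")
  case True
  have "x \<le> 0"
  proof (rule ccontr)
    assume "\<not> x \<le> 0"
    then have x: "x > 0" by simp
    \<comment> \<open>With \<open>P = 0\<close> only the second term is left, and this scale makes
      it equal to \<open>x / 2\<close>.\<close>
    define \<mu> where "\<mu> = (x / (2 * R)) powr (- (p - 1))"
    have "- (p - 1) * (- 1 / (p - 1)) = 1"
      using p by (simp add: field_simps)
    then have "\<mu> powr (- 1 / (p - 1)) = x / (2 * R)"
      using x R by (simp only: \<mu>_def powr_powr) simp
    moreover have "\<mu> > 0" using x R by (simp add: \<mu>_def)
    ultimately have "x \<le> x / 2"
      using le[of \<mu>] True R by simp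
    then show False using x by simp
  qed
  then show ?thesis using True by simp
next
  case False
  then have P: "P > 0" using P by simp
  \<comment> \<open>This value balances the two terms: each becomes
    \<open>P powr (1 / p) * R powr (1 - 1 / p)\<close>, whence the factor 2.\<close>
  define \<mu> where "\<mu> = (R / P) powr (1 - 1 / p)"
  have \<mu>: "\<mu> > 0" using P R by (simp add: \<mu>_def)
  have 1: "\<mu> * P = P powr (1 / p) * R powr (1 - 1 / p)"
    using P R by (simp add: \<mu>_def powr_divide powr_diff field_simps)
  have "(1 - 1 / p) * (- 1 / (p - 1)) = - (1 / p)"
    using p by (simp add: field_simps)
  then have "\<mu> powr (- 1 / (p - 1)) = (R / P) powr (- (1 / p))"
    by (simp only: \<mu>_def powr_powr)
  also have "\<dots> * R = P powr (1 / p) * R powr (1 - 1 / p)"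
    using P R by (simp add: powr_divide powr_diff powr_minus field_simps)
  finally show ?thesis
    using le[OF \<mu>] 1 by simp
qed

section \<open>The cone estimate\<close>

lemma nn_integral_energy_density:
  fixes u :: "(real^'m) \<times> real \<Rightarrow> real"
  assumes "u \<in> Cc_inf_half" "p > 0"
  shows "(\<integral>\<^sup>+z. ennreal (indicator upper_half z *
      (onorm (frechet_derivative u (at z)) powr p * snd z powr \<gamma>)) \<partial>lborel) = ennreal (weighted_energy p \<gamma> u)"
  using energy_integrable[OF assms, of \<gamma>]
  unfolding weighted_energy_def set_lebesgue_integral_def set_integrable_def
  by (subst nn_integral_eq_integral) auto

lemma emeasure_lborel_ball:
  fixes c :: "'a::euclidean_space"
  shows "emeasure lborel (ball c r) = ennreal (measure lborel (ball c r))"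
  using emeasure_lborel_ball_finite[of c r] by (simp add: emeasure_eq_ennreal_measure less_top)

text \<open>Young's inequality is applied at each point of each segment with the factor
  \<open>\<mu> * s ^ CARD('m) * height powr \<gamma>\<close>: the first term becomes the energy
  density times the cone Jacobian, the second depends on \<open>s\<close> alone and is controlled by
  \<open>B\<close>. The offset \<open>c\<close> of the base allows oblique cones.\<close>

lemma cone_estimate_scaled:
  fixes u :: "(real^'m) \<times> real \<Rightarrow> real" and a :: "(real^'m) \<times> real"
  assumes u: "u \<in> Cc_inf_half" and p: "p > 1" and \<mu>: "\<mu> > 0"
    and d: "d > 0" and c: "norm c \<le> d" and r: "d \<le> \<bar>r\<bar>" "\<bar>r\<bar> \<le> 3 * d" and T: "T \<ge> 0"
    and above: "\<And>s. 0 < s \<Longrightarrow> s < T \<Longrightarrow> 0 < snd a + s * r"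
    and B: "B \<ge> 0" "(\<integral>\<^sup>+s. ennreal (s powr - (real CARD('m) / (p - 1)) * (snd a + s * r) powr - (\<gamma> / (p - 1)))
            * indicator {0<..<T} s \<partial>lborel) \<le> ennreal B"
  shows "(\<integral>\<^sup>+w. ennreal \<bar>u (a + T *\<^sub>R (c + d *\<^sub>R w, r)) - u a\<bar> * indicator (ball 0 1) w \<partial>lborel)
    \<le> ennreal (5 * d * (\<mu> * (weighted_energy p \<gamma> u / d ^ (CARD('m) + 1)) +
         \<mu> powr (- 1 / (p - 1)) * (measure lborel (ball (0::real^'m) 1) * B)))"
proof -
  let ?m = "CARD('m)" and ?W = "ball (0::real^'m) 1"
  let ?F = "\<lambda>z. onorm (frechet_derivative u (at z))"
  let ?I = "weighted_energy p \<gamma> u"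
  define G where "G z = ennreal (indicator upper_half z * (?F z powr p * snd z powr \<gamma>))" for z
  \<comment> \<open>The dual weight: the power -1/(p-1) of Jacobian factor times weight.\<close>
  define \<phi> where "\<phi> s = s powr - (real ?m / (p - 1)) * (snd a + s * r) powr - (\<gamma> / (p - 1))" for s
  define \<nu> where "\<nu> = \<mu> powr (- 1 / (p - 1))"
  let ?path = "\<lambda>s w. a + s *\<^sub>R (c + d *\<^sub>R w, r)"
  have smooth: "smooth_fun u"
    using u by (simp add: Cc_inf_half_def)
  have F0: "?F z \<ge> 0" for z
    using smooth_fun_differentiable[OF smooth] frechet_derivative_works
      has_derivative_bounded_linear onorm_pos_le by blast
  have [measurable]: "?F \<in> borel_measurable borel"
    using smooth_fun_continuous_onorm[OF smooth] by (rule borel_measurable_continuous_onI)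
  have "open (upper_half :: ((real^'m) \<times> real) set)"
    unfolding upper_half_def by (intro open_Collect_less continuous_intros)
  then have [measurable]: "(upper_half :: ((real^'m) \<times> real) set) \<in> sets borel"
    by (rule borel_open)
  have [measurable]: "(snd :: (real^'m) \<times> real \<Rightarrow> real) \<in> borel_measurable borel"
    by (intro borel_measurable_continuous_onI continuous_intros)
  have [measurable]: "?W \<in> sets borel"
    by simp
  have [measurable]: "G \<in> borel_measurable borel"
    unfolding G_def by measurable
  have [measurable]: "\<phi> \<in> borel_measurable borel"
    unfolding \<phi>_def by measurable
  have G_int: "(\<integral>\<^sup>+z. G z \<partial>lborel) = ennreal ?I"
    using nn_integral_energy_density[OF u] p by (simp add: G_def)
  have pointwise: "ennreal (?F (?path s w) * norm (c + d *\<^sub>R w, r)) * indicator {0<..<T} s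
      \<le> ennreal (5 * d * \<mu>) * (G (?path s w) * ennreal (s ^ ?m) * indicator {0<..<T} s)
        + ennreal (5 * d * \<nu>) * (ennreal (\<phi> s) * indicator {0<..<T} s)"
    if w: "w \<in> ?W" for s w
  proof (cases "s \<in> {0<..<T}")
    case True
    define z where "z = ?path s w"
    define h where "h = snd a + s * r"
    have s: "s > 0" and h: "h > 0" using True above by (auto simp: h_def)
    have z: "snd z = h" "z \<in> upper_half" using h by (auto simp: z_def h_def upper_half_def)
    \<comment> \<open>The direction of the segment has length at most \<open>d + d + 3 * d\<close>,
      which is the source of the constant 5.\<close>
    have "norm (c + d *\<^sub>R w, r) \<le> norm (c + d *\<^sub>R w) + norm r"
      using norm_Pair_le by blast
    also have "\<dots> \<le> norm c + d * norm w + \<bar>r\<bar>"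
      using norm_triangle_ineq[of c "d *\<^sub>R w"] d by simp
    also have "\<dots> \<le> d + d * 1 + 3 * d"
      using c r w d by (intro add_mono mult_left_mono) auto
    finally have v: "norm (c + d *\<^sub>R w, r) \<le> 5 * d" by simp
    let ?k = "\<mu> * s ^ ?m * h powr \<gamma>"
    have k: "?k powr (- 1 / (p - 1)) = \<nu> * \<phi> s"
      using \<mu> s h by (simp add: \<nu>_def \<phi>_def h_def[symmetric] powr_mult powr_powr powr_realpow[symmetric])
    have "?F z \<le> ?k * ?F z powr p + ?k powr (- 1 / (p - 1))"
      using \<mu> s h p F0 by (intro weighted_young) auto
    then have F: "?F z \<le> \<mu> * (?F z powr p * h powr \<gamma> * s ^ ?m) + \<nu> * \<phi> s"
      unfolding k by (simp add: mult_ac)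
    have "?F z * norm (c + d *\<^sub>R w, r) \<le> (\<mu> * (?F z powr p * h powr \<gamma> * s ^ ?m) + \<nu> * \<phi> s) * (5 * d)"
      using F v F0[of z] by (intro mult_mono) auto
    also have "\<dots> = 5 * d * \<mu> * (?F z powr p * h powr \<gamma> * s ^ ?m) + 5 * d * \<nu> * \<phi> s"
      by (simp add: algebra_simps)
    finally have "ennreal (?F z * norm (c + d *\<^sub>R w, r)) \<le>
        ennreal (5 * d * \<mu> * (?F z powr p * h powr \<gamma> * s ^ ?m) + 5 * d * \<nu> * \<phi> s)"
      by (rule ennreal_leI)
    also have "\<dots> = ennreal (5 * d * \<mu>) * (G z * ennreal (s ^ ?m)) + ennreal (5 * d * \<nu>) * ennreal (\<phi> s)"
      using d \<mu> s z by (simp add: G_def \<nu>_def \<phi>_def ennreal_plus ennreal_mult)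
    finally show ?thesis
      using True by (simp add: z_def)
  qed simp
  \<comment> \<open>The indicator of the ball is kept only in the second summand, where \<phi> does
    not depend on \<open>w\<close>; the first is enlarged to all \<open>w\<close>, as
    \<open>cone_nn_integral_le\<close> expects.\<close>
  have "(\<integral>\<^sup>+w. ennreal \<bar>u (?path T w) - u a\<bar> * indicator ?W w \<partial>lborel)
      \<le> (\<integral>\<^sup>+w. (\<integral>\<^sup>+s. ennreal (5 * d * \<mu>) * (G (?path s w) * ennreal (s ^ ?m) * indicator {0<..<T} s)
        + ennreal (5 * d * \<nu>) * (ennreal (\<phi> s) * indicator {0<..<T} s * indicator ?W w) \<partial>lborel) \<partial>lborel)"
  proof (rule nn_integral_mono)
    fix w :: "real^'m"
    show "ennreal \<bar>u (?path T w) - u a\<bar> * indicator ?W w \<le>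
      (\<integral>\<^sup>+s. ennreal (5 * d * \<mu>) * (G (?path s w) * ennreal (s ^ ?m) * indicator {0<..<T} s)
        + ennreal (5 * d * \<nu>) * (ennreal (\<phi> s) * indicator {0<..<T} s * indicator ?W w) \<partial>lborel)"
    proof (cases "w \<in> ?W")
      case True
      have "ennreal \<bar>u (?path T w) - u a\<bar> \<le>
        (\<integral>\<^sup>+s. ennreal (?F (?path s w) * norm (c + d *\<^sub>R w, r)) * indicator {0<..<T} s \<partial>lborel)"
        by (rule segment_increment_le[OF smooth T])
      also have "\<dots> \<le> (\<integral>\<^sup>+s. ennreal (5 * d * \<mu>) * (G (?path s w) * ennreal (s ^ ?m) * indicator {0<..<T} s)
        + ennreal (5 * d * \<nu>) * (ennreal (\<phi> s) * indicator {0<..<T} s) \<partial>lborel)"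
        by (rule nn_integral_mono) (rule pointwise[OF True])
      finally show ?thesis using True by (simp only: indicator_simps mult_1_right)
    qed simp
  qed
  also have "\<dots> = ennreal (5 * d * \<mu>) *
        (\<integral>\<^sup>+w. (\<integral>\<^sup>+s. G (?path s w) * ennreal (s ^ ?m) * indicator {0<..<T} s \<partial>lborel) \<partial>lborel)
      + ennreal (5 * d * \<nu>) *
        (\<integral>\<^sup>+w. (\<integral>\<^sup>+s. ennreal (\<phi> s) * indicator {0<..<T} s * indicator ?W w \<partial>lborel) \<partial>lborel)"
  proof -
    have [measurable]: "(\<lambda>w. \<integral>\<^sup>+s. G (?path s w) * ennreal (s ^ ?m) * indicator {0<..<T} s \<partial>lborel) \<in> borel_measurable lborel"
      by measurable
    have [measurable]: "(\<lambda>w. \<integral>\<^sup>+s. ennreal (\<phi> s) * indicator {0<..<T} s * indicator ?W w \<partial>lborel) \<in> borel_measurable lborel"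
      by measurable
    show ?thesis
      by (subst nn_integral_add, measurable)+ (subst nn_integral_cmult, measurable)+
  qed
  also have "(\<integral>\<^sup>+w. (\<integral>\<^sup>+s. ennreal (\<phi> s) * indicator {0<..<T} s * indicator ?W w \<partial>lborel) \<partial>lborel)
      = (\<integral>\<^sup>+s. ennreal (\<phi> s) * indicator {0<..<T} s \<partial>lborel) * ennreal (measure lborel ?W)"
    by (simp add: nn_integral_multc nn_integral_cmult emeasure_lborel_ball[symmetric])
  also have "ennreal (5 * d * \<mu>) *
        (\<integral>\<^sup>+w. (\<integral>\<^sup>+s. G (?path s w) * ennreal (s ^ ?m) * indicator {0<..<T} s \<partial>lborel) \<partial>lborel)
      + ennreal (5 * d * \<nu>) *
        ((\<integral>\<^sup>+s. ennreal (\<phi> s) * indicator {0<..<T} s \<partial>lborel) * ennreal (measure lborel ?W))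
      \<le> ennreal (5 * d * \<mu>) * ennreal (?I / d ^ (?m + 1)) +
        ennreal (5 * d * \<nu>) * (ennreal B * ennreal (measure lborel ?W))"
  proof (intro add_mono mult_left_mono mult_right_mono)
    have "(\<integral>\<^sup>+w. (\<integral>\<^sup>+s. G (?path s w) * ennreal (s ^ ?m) * indicator {0<..<T} s \<partial>lborel) \<partial>lborel)
        \<le> ennreal (1 / (d ^ ?m * \<bar>r\<bar>)) * ennreal ?I"
      using cone_nn_integral_le[of G d r a c T] d r G_int by (auto simp: DIM_cart)
    \<comment> \<open>The lower bound \<open>d\<close> for |r| prevents the cone from being too
      flat.\<close>
    also have "\<dots> \<le> ennreal (1 / d ^ (?m + 1)) * ennreal ?I"
      using d r by (intro mult_right_mono ennreal_leI divide_left_mono) (auto simp: mult.commute)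
    also have "\<dots> = ennreal (?I / d ^ (?m + 1))"
      using d weighted_energy_nonneg[of p \<gamma> u] by (simp add: ennreal_mult[symmetric])
    finally show "(\<integral>\<^sup>+w. (\<integral>\<^sup>+s. G (?path s w) * ennreal (s ^ ?m) * indicator {0<..<T} s \<partial>lborel) \<partial>lborel)
        \<le> ennreal (?I / d ^ (?m + 1))" .
  qed (use B in \<open>auto simp: \<phi>_def\<close>)
  also have "\<dots> = ennreal (5 * d * (\<mu> * (?I / d ^ (?m + 1)) + \<nu> * (measure lborel ?W * B)))"
    using d \<mu> B weighted_energy_nonneg[of p \<gamma> u]
    by (simp add: \<nu>_def ennreal_mult[symmetric] ennreal_plus[symmetric] distrib_left mult_ac del: ennreal_plus)
  finally show ?thesis by (simp add: \<nu>_def)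
qed

text \<open>Optimising \<mu> in the scaled estimate gives the Hoelder form. The reference height
  \<open>h\<close> is not tied to the apex, and \<open>b\<close> is the size of the one-dimensional
  dual integral relative to it. The exponents come from (-\<gamma>/(p-1)) * (1 - 1/p) = -\<gamma>/p
  and d * (d^(-n))^(1/p) = d^(1 - n/p).\<close>

lemma cone_estimate:
  fixes u :: "(real^'m) \<times> real \<Rightarrow> real" and a :: "(real^'m) \<times> real"
  defines "n \<equiv> real CARD('m) + 1" and "V \<equiv> measure lborel (ball (0::real^'m) 1)"
  assumes u: "u \<in> Cc_inf_half" and p: "p > 1"
    and d: "d > 0" and c: "norm c \<le> d" and r: "d \<le> \<bar>r\<bar>" "\<bar>r\<bar> \<le> 3 * d" and T: "T \<ge> 0"
    and above: "\<And>s. 0 < s \<Longrightarrow> s < T \<Longrightarrow> 0 < snd a + s * r"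
    and h: "h > 0" and b: "b > 0" "(\<integral>\<^sup>+s. ennreal (s powr - ((n - 1) / (p - 1)) * (snd a + s * r) powr - (\<gamma> / (p - 1)))
            * indicator {0<..<T} s \<partial>lborel) \<le> ennreal (b * h powr - (\<gamma> / (p - 1)))"
  shows "(\<integral>\<^sup>+w. ennreal \<bar>u (a + T *\<^sub>R (c + d *\<^sub>R w, r)) - u a\<bar> * indicator (ball 0 1) w \<partial>lborel)
    \<le> ennreal (10 * (V * b) powr (1 - 1 / p) * d powr (1 - n / p) * h powr - (\<gamma> / p)
          * weighted_energy p \<gamma> u powr (1 / p))"
proof -
  let ?I = "weighted_energy p \<gamma> u" and ?B = "b * h powr - (\<gamma> / (p - 1))"
  let ?X = "\<integral>\<^sup>+w. ennreal \<bar>u (a + T *\<^sub>R (c + d *\<^sub>R w, r)) - u a\<bar> * indicator (ball 0 1) w \<partial>lborel"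
  define P where "P = ?I / d ^ (CARD('m) + 1)"
  define R where "R = V * ?B"
  have V: "V > 0"
    unfolding V_def by (simp add: content_ball_pos)
  have P: "P \<ge> 0" and R: "R > 0"
    using d V b h weighted_energy_nonneg[of p \<gamma> u] by (auto simp: P_def R_def)
  have scaled: "?X \<le> ennreal (5 * d * (\<mu> * P + \<mu> powr (- 1 / (p - 1)) * R))" if "\<mu> > 0" for \<mu>
    using cone_estimate_scaled[OF u p that d c r T above, where B = ?B and \<gamma> = \<gamma>] b h
    by (simp add: P_def R_def V_def n_def)
  \<comment> \<open>A single value of \<mu> shows that the integral is finite, so the optimisation
    can be carried out in the reals.\<close>
  have "?X < \<infinity>"
    using scaled[of 1] by (simp add: order_le_less_trans)
  then obtain x where x: "?X = ennreal x" "x \<ge> 0"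
    by (cases ?X) auto
  have "x / (5 * d) \<le> \<mu> * P + \<mu> powr (- 1 / (p - 1)) * R" if "\<mu> > 0" for \<mu>
  proof -
    have "0 \<le> \<mu> * P + \<mu> powr (- 1 / (p - 1)) * R"
      using that P R by simp
    then have "x \<le> 5 * d * (\<mu> * P + \<mu> powr (- 1 / (p - 1)) * R)"
      using scaled[OF that] x d by simp
    then show ?thesis using d by (simp add: field_simps)
  qed
  then have "x / (5 * d) \<le> 2 * P powr (1 / p) * R powr (1 - 1 / p)"
    using P R p by (intro optimize_scaling) auto
  then have "x \<le> 10 * (d * P powr (1 / p)) * R powr (1 - 1 / p)"
    using d by (simp add: field_simps)
  also have "d * P powr (1 / p) = d powr (1 - n / p) * ?I powr (1 / p)"
  proof -
    have "d ^ (CARD('m) + 1) = d powr n"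
      using d by (simp add: n_def powr_add powr_realpow)
    then have "P powr (1 / p) = ?I powr (1 / p) / d powr (n / p)"
      using d weighted_energy_nonneg by (simp add: P_def powr_divide powr_powr)
    then show ?thesis
      using d by (simp add: powr_diff)
  qed
  also have "R powr (1 - 1 / p) = (V * b) powr (1 - 1 / p) * h powr - (\<gamma> / p)"
  proof -
    have "- (\<gamma> / (p - 1)) * (1 - 1 / p) = - (\<gamma> / p)"
      using p by (simp add: divide_simps)
    then have "(h powr - (\<gamma> / (p - 1))) powr (1 - 1 / p) = h powr - (\<gamma> / p)"
      by (simp only: powr_powr)
    then show ?thesis
      using V b h by (simp add: R_def powr_mult mult.assoc)
  qed
  finally show ?thesis
    unfolding x by (simp add: mult_ac ennreal_leI)
qed

section \<open>Bounds for a single value of \<open>u\<close>\<close>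

text \<open>When \<open>u\<close> vanishes on the base, every increment equals |u a|, so integration
  over the unit ball gives |u a| times \<open>V\<close>. Taking both \<open>d\<close> and |r| equal
  to the apex height merges the powers of \<open>d\<close> and \<open>h\<close> into one. The sign
  of \<open>r\<close> chooses between a downward and an upward cone.\<close>

lemma vertex_estimate:
  fixes u :: "(real^'m) \<times> real \<Rightarrow> real" and a :: "(real^'m) \<times> real"
  defines "n \<equiv> real CARD('m) + 1" and "V \<equiv> measure lborel (ball (0::real^'m) 1)"
  assumes u: "u \<in> Cc_inf_half" and p: "p > 1"
    and h: "snd a = h" "h > 0" and r: "\<bar>r\<bar> = h" and T: "T \<ge> 0"
    and above: "\<And>s. 0 < s \<Longrightarrow> s < T \<Longrightarrow> 0 < h + s * r"
    and b: "b > 0" "(\<integral>\<^sup>+s. ennreal (s powr - ((n - 1) / (p - 1)) * (h + s * r) powr - (\<gamma> / (p - 1)))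
            * indicator {0<..<T} s \<partial>lborel) \<le> ennreal (b * h powr - (\<gamma> / (p - 1)))"
    and zero: "\<And>w. u (a + T *\<^sub>R (h *\<^sub>R w, r)) = 0"
  shows "\<bar>u a\<bar> \<le> 10 * (V * b) powr (1 - 1 / p) / V * h powr (1 - (n + \<gamma>) / p)
          * weighted_energy p \<gamma> u powr (1 / p)"
proof -
  have V: "V > 0"
    unfolding V_def by (simp add: content_ball_pos)
  have "ennreal (\<bar>u a\<bar> * V) = (\<integral>\<^sup>+w. ennreal \<bar>u (a + T *\<^sub>R (0 + h *\<^sub>R w, r)) - u a\<bar> * indicator (ball (0::real^'m) 1) w \<partial>lborel)"
    using V by (simp only: add_0_left zero diff_0 abs_minus_cancel)
      (simp add: nn_integral_cmult_indicator emeasure_lborel_ball V_def ennreal_mult)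
  also have "\<dots> \<le> ennreal (10 * (V * b) powr (1 - 1 / p) * h powr (1 - n / p) * h powr - (\<gamma> / p)
          * weighted_energy p \<gamma> u powr (1 / p))"
    unfolding V_def n_def
    by (rule cone_estimate) (use assms in auto)
  finally have "\<bar>u a\<bar> * V \<le> 10 * (V * b) powr (1 - 1 / p) * h powr (1 - n / p) * h powr - (\<gamma> / p)
          * weighted_energy p \<gamma> u powr (1 / p)"
    by simp
  also have "\<dots> = 10 * (V * b) powr (1 - 1 / p) * h powr (1 - (n + \<gamma>) / p)
          * weighted_energy p \<gamma> u powr (1 / p)"
    using h by (simp add: powr_add[symmetric] add_divide_distrib algebra_simps)
  finally show ?thesis
    using V by (simp add: field_simps)
qed

text \<open>Downward cone: \<open>u\<close> vanishes on the boundary, and the weight is integrable there.\<close>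

lemma sup_estimate_down:
  fixes \<gamma> p :: real
  defines "n \<equiv> real CARD('m::finite) + 1"
  assumes p: "n < p" and \<gamma>: "\<gamma> < p - 1"
  shows "\<exists>C>0. \<forall>u \<in> (Cc_inf_half :: ((real^'m) \<times> real \<Rightarrow> real) set). \<forall>x\<in>upper_half.
    \<bar>u x\<bar> \<le> C * snd x powr (1 - (n + \<gamma>) / p) * weighted_energy p \<gamma> u powr (1 / p)"
proof -
  define V where "V = measure lborel (ball (0::real^'m) 1)"
  define \<alpha> where "\<alpha> = (n - 1) / (p - 1)"
  define \<delta> where "\<delta> = \<gamma> / (p - 1)"
  have p1: "p > 1" using p by (simp add: n_def)
  have \<alpha>: "\<alpha> < 1" and \<delta>: "\<delta> < 1"
    using p p1 \<gamma> by (auto simp: \<alpha>_def \<delta>_def)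
  \<comment> \<open>The integral of \<open>s powr - \<alpha> * (1 - s) powr - \<delta>\<close> over
    the unit interval. Convergence at the apex is \<open>\<alpha> < 1\<close>, that is
    \<open>n < p\<close>; convergence at the boundary is \<open>\<delta> < 1\<close>, that is
    \<open>\<gamma> < p - 1\<close>.\<close>
  define b where "b = Beta (1 - \<alpha>) (1 - \<delta>)"
  have b: "b > 0"
    using \<alpha> \<delta> by (simp add: b_def Beta_def Gamma_real_pos)
  have V: "V > 0"
    unfolding V_def by (simp add: content_ball_pos)
  show ?thesis
  proof (intro exI[of _ "10 * (V * b) powr (1 - 1 / p) / V"] conjI ballI)
    show "10 * (V * b) powr (1 - 1 / p) / V > 0"
      using V b by simp
    fix u :: "(real^'m) \<times> real \<Rightarrow> real" and x :: "(real^'m) \<times> real"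
    assume u: "u \<in> Cc_inf_half" and "x \<in> upper_half"
    then have h: "snd x > 0" by (simp add: upper_half_def)
    have "(\<integral>\<^sup>+s. ennreal (s powr - \<alpha> * (snd x + s * - snd x) powr - \<delta>) * indicator {0<..<1} s \<partial>lborel)
        \<le> (\<integral>\<^sup>+s. ennreal (snd x powr - \<delta>) * (ennreal (s powr - \<alpha> * (1 - s) powr - \<delta>) * indicator {0..1} s) \<partial>lborel)"
    proof (rule nn_integral_mono)
      fix s :: real
      have eq: "snd x + s * - snd x = snd x * (1 - s)"
        by (simp add: algebra_simps)
      show "ennreal (s powr - \<alpha> * (snd x + s * - snd x) powr - \<delta>) * indicator {0<..<1} s
        \<le> ennreal (snd x powr - \<delta>) * (ennreal (s powr - \<alpha> * (1 - s) powr - \<delta>) * indicator {0..1} s)"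
        unfolding eq using h
        by (cases "s \<in> {0<..<1}") (auto simp: powr_mult ennreal_mult[symmetric] mult_ac)
    qed
    also have "\<dots> = ennreal (snd x powr - \<delta>) *
        (\<integral>\<^sup>+s. ennreal (s powr - \<alpha> * (1 - s) powr - \<delta>) * indicator {0..1} s \<partial>lborel)"
      by (rule nn_integral_cmult) measurable
    also have "(\<integral>\<^sup>+s. ennreal (s powr - \<alpha> * (1 - s) powr - \<delta>) * indicator {0..1} s \<partial>lborel) = ennreal b"
      using has_integral_Beta_real[of "1 - \<alpha>" "1 - \<delta>"] \<alpha> \<delta>
      by (intro nn_integral_has_integral_lebesgue') (auto simp: b_def)
    finally have int: "(\<integral>\<^sup>+s. ennreal (s powr - \<alpha> * (snd x + s * - snd x) powr - \<delta>) * indicator {0<..<1} s \<partial>lborel)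
        \<le> ennreal (b * snd x powr - \<delta>)"
      using b by (simp add: ennreal_mult mult.commute)
    have above: "0 < snd x + s * - snd x" if "0 < s" "s < 1" for s
    proof -
      have "s * snd x < 1 * snd x"
        using that h by (intro mult_strict_right_mono) auto
      then show ?thesis by simp
    qed
    \<comment> \<open>At parameter 1 the path has height exactly 0, hence lies outside the open
      half-space.\<close>
    have zero: "u (x + 1 *\<^sub>R (snd x *\<^sub>R w, - snd x)) = 0" for w
      by (rule Cc_inf_half_zero_outside_upper_half[OF u]) simp
    show "\<bar>u x\<bar> \<le> 10 * (V * b) powr (1 - 1 / p) / V * snd x powr (1 - (n + \<gamma>) / p)
          * weighted_energy p \<gamma> u powr (1 / p)"
      unfolding V_def n_def
      by (rule vertex_estimate[where r = "- snd x" and T = 1, OF u p1 refl h _ _ above b _ zero])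
         (use int h in \<open>auto simp: \<alpha>_def \<delta>_def n_def\<close>)
  qed
qed

text \<open>Weights occur with exponents of either sign: for \<open>e \<ge> 0\<close> the upper
  bound on \<open>v\<close> is used, for negative \<open>e\<close> the lower one.\<close>

lemma powr_le_comparable:
  fixes t v e k :: real
  assumes "t > 0" "k \<ge> 1" "v \<le> k * t" "t \<le> k * v"
  shows "v powr e \<le> k powr \<bar>e\<bar> * t powr e"
proof (cases "e \<ge> 0")
  case True
  have "v > 0" using assms by (metis less_le_trans mult_pos_pos zero_less_mult_pos zero_less_one)
  then have "v powr e \<le> (k * t) powr e"
    using True assms by (intro powr_mono2) auto
  then show ?thesis using assms True by (simp add: powr_mult)
next
  case False
  have "v powr e \<le> (t / k) powr e"
    using False assms by (intro powr_mono2') (auto simp: field_simps)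
  then show ?thesis
    using assms False by (simp add: powr_divide powr_minus field_simps)
qed

text \<open>Upward cone: \<open>u\<close> vanishes far away, and the weight is integrable at infinity.\<close>

lemma sup_estimate_up:
  fixes \<gamma> p :: real
  defines "n \<equiv> real CARD('m::finite) + 1"
  assumes p: "n < p" and \<gamma>: "\<gamma> > p - n"
  shows "\<exists>C>0. \<forall>u \<in> (Cc_inf_half :: ((real^'m) \<times> real \<Rightarrow> real) set). \<forall>x\<in>upper_half.
    \<bar>u x\<bar> \<le> C * snd x powr (1 - (n + \<gamma>) / p) * weighted_energy p \<gamma> u powr (1 / p)"
proof -
  define V where "V = measure lborel (ball (0::real^'m) 1)"
  define \<alpha> where "\<alpha> = (n - 1) / (p - 1)"
  define \<delta> where "\<delta> = \<gamma> / (p - 1)"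
  have p1: "p > 1" using p by (simp add: n_def)
  have \<alpha>: "\<alpha> < 1" and \<alpha>\<delta>: "\<alpha> + \<delta> > 1"
    using p p1 \<gamma> by (auto simp: \<alpha>_def \<delta>_def add_divide_distrib[symmetric])
  \<comment> \<open>Near the apex \<open>1 + s\<close> is comparable to 1 and far out to
    \<open>s\<close>, both within a factor 2; the two fractions are the integrals of the resulting
    pure powers. Convergence at infinity is \<open>\<alpha> + \<delta> > 1\<close>, that is
    \<open>\<gamma> > p - n\<close>.\<close>
  define b where "b = 2 powr \<bar>\<delta>\<bar> * (1 / (1 - \<alpha>) + 1 / (\<alpha> + \<delta> - 1))"
  have b: "b > 0"
    using \<alpha> \<alpha>\<delta> by (auto simp: b_def intro!: mult_pos_pos add_pos_pos)
  have V: "V > 0"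
    unfolding V_def by (simp add: content_ball_pos)
  show ?thesis
  proof (intro exI[of _ "10 * (V * b) powr (1 - 1 / p) / V"] conjI ballI)
    show "10 * (V * b) powr (1 - 1 / p) / V > 0"
      using V b by simp
    fix u :: "(real^'m) \<times> real \<Rightarrow> real" and x :: "(real^'m) \<times> real"
    assume u: "u \<in> Cc_inf_half" and "x \<in> upper_half"
    then have h: "snd x > 0" by (simp add: upper_half_def)
    have "bounded (closure {z. u z \<noteq> 0})"
      using u by (auto simp: Cc_inf_half_def compact_imp_bounded)
    then obtain \<rho> where \<rho>: "\<rho> > 0" "\<And>z. z \<in> closure {z. u z \<noteq> 0} \<Longrightarrow> norm z \<le> \<rho>"
      by (auto simp: bounded_pos)
    \<comment> \<open>The cone is stopped at height \<open>snd x + \<rho>\<close>, beyond the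
      support. \<open>T\<close> depends on \<open>u\<close>, but the bound \<open>b\<close> does
      not, since it comes from integrals over the whole half-line.\<close>
    define T where "T = \<rho> / snd x"
    have T: "T \<ge> 0" using \<rho> h by (simp add: T_def)
    have "(\<integral>\<^sup>+s. ennreal (s powr - \<alpha> * (snd x + s * snd x) powr - \<delta>) * indicator {0<..<T} s \<partial>lborel)
        \<le> (\<integral>\<^sup>+s. ennreal (2 powr \<bar>\<delta>\<bar> * snd x powr - \<delta>) * (ennreal (s powr - \<alpha>) * indicator {0..1} s
            + ennreal (s powr (- \<alpha> - \<delta>)) * indicator {1..} s) \<partial>lborel)"
    proof (rule nn_integral_mono)
      fix s :: real
      have eq: "snd x + s * snd x = snd x * (1 + s)"
        by (simp add: algebra_simps)
      have small: "s powr - \<alpha> * (snd x * (1 + s)) powr - \<delta> \<le> 2 powr \<bar>\<delta>\<bar> * snd x powr - \<delta> * s powr - \<alpha>"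
        if "0 < s" "s \<le> 1"
      proof -
        have "(1 + s) powr - \<delta> \<le> 2 powr \<bar>- \<delta>\<bar> * 1 powr - \<delta>"
          by (rule powr_le_comparable) (use that in auto)
        then have "(s powr - \<alpha> * snd x powr - \<delta>) * (1 + s) powr - \<delta> \<le> (s powr - \<alpha> * snd x powr - \<delta>) * 2 powr \<bar>\<delta>\<bar>"
          by (intro mult_left_mono) auto
        then show ?thesis using h that by (simp add: powr_mult mult_ac)
      qed
      have large: "s powr - \<alpha> * (snd x * (1 + s)) powr - \<delta> \<le> 2 powr \<bar>\<delta>\<bar> * snd x powr - \<delta> * s powr (- \<alpha> - \<delta>)"
        if "1 \<le> s"
      proof -
        have "(1 + s) powr - \<delta> \<le> 2 powr \<bar>- \<delta>\<bar> * s powr - \<delta>"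
          by (rule powr_le_comparable) (use that in auto)
        then have "(s powr - \<alpha> * snd x powr - \<delta>) * (1 + s) powr - \<delta>
            \<le> (s powr - \<alpha> * snd x powr - \<delta>) * (2 powr \<bar>\<delta>\<bar> * s powr - \<delta>)"
          by (intro mult_left_mono) auto
        moreover have "s powr (- \<alpha> - \<delta>) = s powr - \<alpha> * s powr - \<delta>"
          by (simp add: powr_add[symmetric])
        ultimately show ?thesis using h that by (simp add: powr_mult mult_ac)
      qed
      consider "s \<notin> {0<..<T}" | "s \<in> {0<..<T}" "s < 1" | "s \<in> {0<..<T}" "s = 1" | "s \<in> {0<..<T}" "s > 1"
        by fastforce
      then show "ennreal (s powr - \<alpha> * (snd x + s * snd x) powr - \<delta>) * indicator {0<..<T} s
        \<le> ennreal (2 powr \<bar>\<delta>\<bar> * snd x powr - \<delta>) * (ennreal (s powr - \<alpha>) * indicator {0..1} s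
            + ennreal (s powr (- \<alpha> - \<delta>)) * indicator {1..} s)"
      proof cases
        case 2
        then show ?thesis
          unfolding eq using small h by (auto simp: ennreal_mult[symmetric] intro!: ennreal_leI)
      next
        \<comment> \<open>At \<open>s = 1\<close> both indicators on the right equal 1, so the spare
          summand is discarded explicitly.\<close>
        case 3
        have "ennreal (s powr - \<alpha> * (snd x * (1 + s)) powr - \<delta>)
            \<le> ennreal (2 powr \<bar>\<delta>\<bar> * snd x powr - \<delta> * s powr - \<alpha>)"
          using 3 by (intro ennreal_leI small) auto
        also have "\<dots> = ennreal (2 powr \<bar>\<delta>\<bar> * snd x powr - \<delta>) * (ennreal (s powr - \<alpha>) + 0)"
          using h by (simp add: ennreal_mult)
        also have "\<dots> \<le> ennreal (2 powr \<bar>\<delta>\<bar> * snd x powr - \<delta>) * (ennreal (s powr - \<alpha>) + ennreal (s powr (- \<alpha> - \<delta>)))"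
          by (intro mult_left_mono add_left_mono) auto
        finally show ?thesis
          unfolding eq using 3 by simp
      next
        case 4
        then show ?thesis
          unfolding eq using large h by (auto simp: ennreal_mult[symmetric] intro!: ennreal_leI)
      qed simp
    qed
    also have "\<dots> = ennreal (2 powr \<bar>\<delta>\<bar> * snd x powr - \<delta>) *
        ((\<integral>\<^sup>+s. ennreal (s powr - \<alpha>) * indicator {0..1} s \<partial>lborel)
          + (\<integral>\<^sup>+s. ennreal (s powr (- \<alpha> - \<delta>)) * indicator {1..} s \<partial>lborel))"
      by (simp add: nn_integral_cmult nn_integral_add)
    also have "(\<integral>\<^sup>+s. ennreal (s powr - \<alpha>) * indicator {0..1} s \<partial>lborel) = ennreal (1 / (1 - \<alpha>))"
      using has_integral_powr_from_0[of "- \<alpha>" 1] \<alpha>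
      by (intro nn_integral_has_integral_lebesgue') auto
    also have "(\<integral>\<^sup>+s. ennreal (s powr (- \<alpha> - \<delta>)) * indicator {1..} s \<partial>lborel) = ennreal (1 / (\<alpha> + \<delta> - 1))"
    proof -
      have "- (1 powr (- \<alpha> - \<delta> + 1)) / (- \<alpha> - \<delta> + 1) = 1 / (\<alpha> + \<delta> - 1)"
        using \<alpha>\<delta> by (simp add: divide_simps)
      then show ?thesis
        using has_integral_powr_to_inf[of "- \<alpha> - \<delta>" 1] \<alpha>\<delta>
        by (intro nn_integral_has_integral_lebesgue') auto
    qed
    finally have int: "(\<integral>\<^sup>+s. ennreal (s powr - \<alpha> * (snd x + s * snd x) powr - \<delta>) * indicator {0<..<T} s \<partial>lborel)
        \<le> ennreal (b * snd x powr - \<delta>)"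
      using \<alpha> \<alpha>\<delta> by (simp add: b_def ennreal_mult[symmetric] ennreal_plus[symmetric] mult_ac del: ennreal_plus)
    have zero: "u (x + T *\<^sub>R (snd x *\<^sub>R w, snd x)) = 0" for w
    proof -
      let ?z = "x + T *\<^sub>R (snd x *\<^sub>R w, snd x)"
      have "snd ?z = snd x + \<rho>" using h by (simp add: T_def)
      moreover have "\<bar>snd ?z\<bar> \<le> norm ?z"
        by (metis norm_snd_le prod.collapse real_norm_def)
      ultimately have "norm ?z > \<rho>" using h by linarith
      then have "?z \<notin> closure {z. u z \<noteq> 0}" using \<rho>(2) not_le by blast
      then show ?thesis by (rule Cc_inf_half_zero_outside[OF u])
    qed
    have above: "0 < snd x + s * snd x" if "0 < s" "s < T" for s
      using that h by (simp add: add_pos_pos)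
    show "\<bar>u x\<bar> \<le> 10 * (V * b) powr (1 - 1 / p) / V * snd x powr (1 - (n + \<gamma>) / p)
          * weighted_energy p \<gamma> u powr (1 / p)"
      unfolding V_def n_def
      by (rule vertex_estimate[where r = "snd x" and T = T, OF u p1 refl h _ T above b _ zero])
         (use int h in \<open>auto simp: \<alpha>_def \<delta>_def n_def\<close>)
  qed
qed

section \<open>Morrey's estimate for points close relative to their height\<close>

text \<open>The cones with apexes \<open>x\<close> and \<open>y\<close> share a base, and the
  triangle inequality is averaged over it. With M the larger of the two heights, all heights on
  these cones lie between M/2 and 3M, so the weight is comparable to a constant there and every
  \<gamma> is admissible.\<close>

lemma local_estimate:
  fixes \<gamma> p :: real
  defines "n \<equiv> real CARD('m::finite) + 1"
  assumes p: "n < p"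
  shows "\<exists>C>0. \<forall>u \<in> (Cc_inf_half :: ((real^'m) \<times> real \<Rightarrow> real) set). \<forall>x\<in>upper_half. \<forall>y\<in>upper_half.
    2 * dist x y \<le> max (snd x) (snd y) \<longrightarrow>
    \<bar>u x - u y\<bar> \<le> C * dist x y powr (1 - n / p) * max (snd x) (snd y) powr - (\<gamma> / p)
      * weighted_energy p \<gamma> u powr (1 / p)"
proof -
  define V where "V = measure lborel (ball (0::real^'m) 1)"
  define \<alpha> where "\<alpha> = (n - 1) / (p - 1)"
  define \<delta> where "\<delta> = \<gamma> / (p - 1)"
  have p1: "p > 1" using p by (simp add: n_def)
  have \<alpha>: "\<alpha> < 1"
    using p p1 by (auto simp: \<alpha>_def)
  define b where "b = 3 powr \<bar>\<delta>\<bar> / (1 - \<alpha>)"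
  have b: "b > 0"
    using \<alpha> by (simp add: b_def)
  have V: "V > 0"
    unfolding V_def by (simp add: content_ball_pos)
  \<comment> \<open>Comparability of the heights with \<open>M\<close> within a factor 3 reduces the
    dual integral to that of \<open>s powr - \<alpha>\<close>, finite because
    \<open>n < p\<close>.\<close>
  have weight: "(\<integral>\<^sup>+s. ennreal (s powr - \<alpha> * (k + s * r) powr - \<delta>) * indicator {0<..<1} s \<partial>lborel)
        \<le> ennreal (b * M powr - \<delta>)"
    if M: "M > 0" "M \<le> 2 * k" "k + r \<le> 3 * M" and r: "r \<ge> 0" for M k r
  proof -
    have "(\<integral>\<^sup>+s. ennreal (s powr - \<alpha> * (k + s * r) powr - \<delta>) * indicator {0<..<1} s \<partial>lborel)
      \<le> (\<integral>\<^sup>+s. ennreal (3 powr \<bar>\<delta>\<bar> * M powr - \<delta>) * (ennreal (s powr - \<alpha>) * indicator {0..1} s) \<partial>lborel)"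
    proof (rule nn_integral_mono)
      fix s :: real
      have "s powr - \<alpha> * (k + s * r) powr - \<delta> \<le> 3 powr \<bar>\<delta>\<bar> * M powr - \<delta> * s powr - \<alpha>"
        if s: "0 < s" "s < 1"
      proof -
        have sr: "0 \<le> s * r" "s * r \<le> r"
          using s r by (auto simp: mult_left_le_one_le)
        have "(k + s * r) powr - \<delta> \<le> 3 powr \<bar>- \<delta>\<bar> * M powr - \<delta>"
          by (rule powr_le_comparable) (use M sr in auto)
        then have "s powr - \<alpha> * (k + s * r) powr - \<delta> \<le> s powr - \<alpha> * (3 powr \<bar>\<delta>\<bar> * M powr - \<delta>)"
          by (intro mult_left_mono) auto
        then show ?thesis by (simp add: mult_ac)
      qed
      then show "ennreal (s powr - \<alpha> * (k + s * r) powr - \<delta>) * indicator {0<..<1} s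
        \<le> ennreal (3 powr \<bar>\<delta>\<bar> * M powr - \<delta>) * (ennreal (s powr - \<alpha>) * indicator {0..1} s)"
        by (cases "s \<in> {0<..<1}") (auto simp: ennreal_mult[symmetric] intro!: ennreal_leI)
    qed
    also have "\<dots> = ennreal (3 powr \<bar>\<delta>\<bar> * M powr - \<delta>) * (\<integral>\<^sup>+s. ennreal (s powr - \<alpha>) * indicator {0..1} s \<partial>lborel)"
      by (rule nn_integral_cmult) measurable
    also have "(\<integral>\<^sup>+s. ennreal (s powr - \<alpha>) * indicator {0..1} s \<partial>lborel) = ennreal (1 / (1 - \<alpha>))"
      using has_integral_powr_from_0[of "- \<alpha>" 1] \<alpha>
      by (intro nn_integral_has_integral_lebesgue') auto
    finally show ?thesis
      using \<alpha> by (simp add: b_def ennreal_mult[symmetric])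
  qed
  show ?thesis
  \<comment> \<open>The constant is 20 because each of the two cones contributes 10.\<close>
  proof (intro exI[of _ "20 * (V * b) powr (1 - 1 / p) / V"] conjI ballI impI)
    show "20 * (V * b) powr (1 - 1 / p) / V > 0"
      using V b by simp
    fix u :: "(real^'m) \<times> real \<Rightarrow> real" and x y :: "(real^'m) \<times> real"
    assume u: "u \<in> Cc_inf_half" and "x \<in> upper_half" "y \<in> upper_half"
      and near: "2 * dist x y \<le> max (snd x) (snd y)"
    then have pos: "snd x > 0" "snd y > 0" by (auto simp: upper_half_def)
    define M where "M = max (snd x) (snd y)"
    define d where "d = dist x y"
    \<comment> \<open>The vertical distance from \<open>y\<close> to the common base. Placing the
      base \<open>2 * d\<close> above \<open>x\<close> keeps \<open>r\<close> between
      \<open>d\<close> and \<open>3 * d\<close>, because the two heights differ by at most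
      \<open>d\<close>.\<close>
    define r where "r = snd x + 2 * d - snd y"
    define E where "E = 10 * (V * b) powr (1 - 1 / p) * d powr (1 - n / p) * M powr - (\<gamma> / p)
          * weighted_energy p \<gamma> u powr (1 / p)"
    \<comment> \<open>The common base, reached from \<open>x\<close> by an upright cone and from
      \<open>y\<close> by an oblique one with offset \<open>fst x - fst y\<close>.\<close>
    define z where "z w = (fst x + d *\<^sub>R w, snd x + 2 * d)" for w
    show "\<bar>u x - u y\<bar> \<le> 20 * (V * b) powr (1 - 1 / p) / V * dist x y powr (1 - n / p)
        * max (snd x) (snd y) powr - (\<gamma> / p) * weighted_energy p \<gamma> u powr (1 / p)"
    proof (cases "x = y")
      case False
      then have d: "d > 0" by (simp add: d_def)
      have M: "M > 0" "2 * d \<le> M"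
        using pos near by (auto simp: M_def d_def)
      have fst_le: "norm (fst x - fst y) \<le> d" and snd_le: "\<bar>snd x - snd y\<bar> \<le> d"
        using dist_fst_le[of x y] dist_snd_le[of x y] by (auto simp: d_def dist_norm)
      have r: "d \<le> r" "r \<le> 3 * d"
        using snd_le by (auto simp: r_def)
      have height: "M \<le> 2 * snd x" "snd x + 2 * d \<le> 3 * M" "M \<le> 2 * snd y" "snd y + r \<le> 3 * M"
        using M snd_le by (auto simp: M_def r_def)
      have "(\<integral>\<^sup>+w. ennreal \<bar>u (x + 1 *\<^sub>R (0 + d *\<^sub>R w, 2 * d)) - u x\<bar> * indicator (ball 0 1) w \<partial>lborel) \<le> ennreal E"
        unfolding E_def V_def n_def
      proof (rule cone_estimate[OF u p1 d])
        show "(\<integral>\<^sup>+s. ennreal (s powr - ((real CARD('m) + 1 - 1) / (p - 1)) * (snd x + s * (2 * d)) powr - (\<gamma> / (p - 1)))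
            * indicator {0<..<1} s \<partial>lborel) \<le> ennreal (b * M powr - (\<gamma> / (p - 1)))"
          using weight[OF M(1) height(1,2)] d by (simp add: \<alpha>_def \<delta>_def n_def)
      qed (use d b M pos in \<open>auto intro: add_pos_pos\<close>)
      also have "(\<lambda>w. x + 1 *\<^sub>R (0 + d *\<^sub>R w, 2 * d)) = z"
        by (rule ext) (simp add: z_def prod_eq_iff)
      finally have X: "(\<integral>\<^sup>+w. ennreal \<bar>u (z w) - u x\<bar> * indicator (ball 0 1) w \<partial>lborel) \<le> ennreal E" .
      have "(\<integral>\<^sup>+w. ennreal \<bar>u (y + 1 *\<^sub>R ((fst x - fst y) + d *\<^sub>R w, r)) - u y\<bar> * indicator (ball 0 1) w \<partial>lborel) \<le> ennreal E"
        unfolding E_def V_def n_def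
      proof (rule cone_estimate[OF u p1 d fst_le])
        show "(\<integral>\<^sup>+s. ennreal (s powr - ((real CARD('m) + 1 - 1) / (p - 1)) * (snd y + s * r) powr - (\<gamma> / (p - 1)))
            * indicator {0<..<1} s \<partial>lborel) \<le> ennreal (b * M powr - (\<gamma> / (p - 1)))"
          using weight[OF M(1) height(3,4)] d r by (simp add: \<alpha>_def \<delta>_def n_def)
      qed (use d r b M pos in \<open>auto intro: add_pos_pos\<close>)
      also have "(\<lambda>w. y + 1 *\<^sub>R ((fst x - fst y) + d *\<^sub>R w, r)) = z"
        by (rule ext) (simp add: z_def r_def prod_eq_iff)
      finally have Y: "(\<integral>\<^sup>+w. ennreal \<bar>u (z w) - u y\<bar> * indicator (ball 0 1) w \<partial>lborel) \<le> ennreal E" .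
      have [measurable]: "ball (0::real^'m) 1 \<in> sets borel"
        by simp
      have "continuous_on UNIV u"
        using u smooth_fun_differentiable
        by (auto simp: Cc_inf_half_def intro!: continuous_at_imp_continuous_on differentiable_imp_continuous_within)
      then have [measurable]: "u \<in> borel_measurable borel"
        by (rule borel_measurable_continuous_onI)
      have [measurable]: "z \<in> borel_measurable borel"
        unfolding z_def by (intro borel_measurable_continuous_onI continuous_intros)
      have "ennreal (\<bar>u x - u y\<bar> * V) = (\<integral>\<^sup>+w. ennreal \<bar>u x - u y\<bar> * indicator (ball (0::real^'m) 1) w \<partial>lborel)"
        using V by (simp add: nn_integral_cmult_indicator emeasure_lborel_ball V_def ennreal_mult)
      also have "\<dots> \<le> (\<integral>\<^sup>+w. ennreal \<bar>u (z w) - u x\<bar> * indicator (ball 0 1) w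
          + ennreal \<bar>u (z w) - u y\<bar> * indicator (ball 0 1) w \<partial>lborel)"
        by (intro nn_integral_mono)
           (auto simp: distrib_right[symmetric] ennreal_plus[symmetric] simp del: ennreal_plus
             split: split_indicator intro!: ennreal_leI)
      also have "\<dots> = (\<integral>\<^sup>+w. ennreal \<bar>u (z w) - u x\<bar> * indicator (ball 0 1) w \<partial>lborel)
          + (\<integral>\<^sup>+w. ennreal \<bar>u (z w) - u y\<bar> * indicator (ball 0 1) w \<partial>lborel)"
        by (rule nn_integral_add) measurable
      also have "\<dots> \<le> ennreal E + ennreal E"
        using X Y by (rule add_mono)
      also have "\<dots> = ennreal (2 * E)"
        using V b by (simp add: E_def ennreal_plus[symmetric] del: ennreal_plus)
      finally have "\<bar>u x - u y\<bar> * V \<le> 2 * E"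
        by (simp add: E_def)
      then show ?thesis
        using V by (simp add: E_def d_def M_def field_simps)
    qed simp
  qed
qed

section \<open>Lower bounds for the kernel in the two regimes\<close>

text \<open>For close points the maximum in the denominator is the larger height. Equality then
  holds if \<kappa> \<ge> 0; if \<kappa> < 0, the power \<kappa> of the smaller height exceeds or
  equals that of the larger one.\<close>

lemma Theta0_ge_near:
  assumes "snd x > 0" "snd y > 0" and near: "2 * dist x y \<le> max (snd x) (snd y)"
  shows "dist x y powr \<beta> * max (snd x) (snd y) powr (\<kappa> - \<beta>) \<le> Theta0 \<beta> \<kappa> x y"
proof -
  define M where "M = max (snd x) (snd y)"
  have M: "M > 0" "max M (dist x y) = M"
    using assms zero_le_dist[of x y] by (auto simp: M_def)
  show ?thesis
  proof (cases "\<kappa> < 0")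
    case True
    have "min (snd x) (snd y) powr - \<kappa> \<le> M powr - \<kappa>"
      using True assms by (intro powr_mono2) (auto simp: M_def)
    then have "dist x y powr \<beta> / (M powr - \<kappa> * M powr \<beta>) \<le> Theta0 \<beta> \<kappa> x y"
      using True assms M unfolding Theta0_def M_def[symmetric]
      by (auto intro!: divide_left_mono mult_right_mono mult_pos_pos)
    moreover have "dist x y powr \<beta> / (M powr - \<kappa> * M powr \<beta>) = dist x y powr \<beta> * M powr (\<kappa> - \<beta>)"
      using M by (simp add: powr_diff powr_minus field_simps)
    ultimately show ?thesis by (simp add: M_def)
  next
    case False
    then show ?thesis
      using M unfolding Theta0_def M_def[symmetric] by (simp add: powr_diff mult.commute)
  qed
qed

text \<open>The distance is at least half of the maximum in the denominator, so their quotient costs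
  at most a factor \<open>2 powr \<beta>\<close>. What remains is the power \<kappa> of the smaller
  height if \<kappa> < 0 and of the larger one otherwise, in each case the larger of the two
  endpoint powers.\<close>

lemma Theta0_ge_far:
  assumes "snd x > 0" "snd y > 0" "\<beta> \<ge> 0" and far: "max (snd x) (snd y) \<le> 2 * dist x y"
    and a: "a = snd x \<or> a = snd y"
  shows "a powr \<kappa> \<le> 2 powr \<beta> * Theta0 \<beta> \<kappa> x y"
proof -
  define M where "M = max (snd x) (snd y)"
  define D where "D = max M (dist x y)"
  have M: "M > 0" and D: "D > 0" "D \<le> 2 * dist x y"
    using assms zero_le_dist[of x y] by (auto simp: M_def D_def)
  have "D powr \<beta> \<le> (2 * dist x y) powr \<beta>"
    using D assms by (intro powr_mono2) auto
  then have ratio: "1 \<le> 2 powr \<beta> * (dist x y powr \<beta> / D powr \<beta>)"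
    using D by (simp add: powr_mult field_simps)
  show ?thesis
  proof (cases "\<kappa> < 0")
    case True
    let ?m = "min (snd x) (snd y)"
    have "a powr \<kappa> \<le> ?m powr \<kappa> * 1"
      using True assms by (auto intro!: powr_mono2')
    also have "\<dots> \<le> ?m powr \<kappa> * (2 powr \<beta> * (dist x y powr \<beta> / D powr \<beta>))"
      by (intro mult_left_mono ratio) simp
    also have "\<dots> = 2 powr \<beta> * Theta0 \<beta> \<kappa> x y"
      using True assms(1,2) by (simp add: Theta0_def D_def M_def powr_minus field_simps)
    finally show ?thesis .
  next
    case False
    have "a powr \<kappa> \<le> M powr \<kappa> * 1"
      using False assms by (auto simp: M_def intro!: powr_mono2)
    also have "\<dots> \<le> M powr \<kappa> * (2 powr \<beta> * (dist x y powr \<beta> / D powr \<beta>))"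
      by (intro mult_left_mono ratio) simp
    also have "\<dots> = 2 powr \<beta> * Theta0 \<beta> \<kappa> x y"
      using False by (simp add: Theta0_def D_def M_def mult_ac)
    finally show ?thesis .
  qed
qed

section \<open>Combination of the near and far regimes\<close>

theorem theorem1p4:
  fixes \<gamma> p :: real
  defines "n \<equiv> real (CARD('m::finite)) + 1"
  assumes "n < p"
  shows "\<exists>C>0. \<forall>u \<in> (Cc_inf_half :: ((real^'m) \<times> real \<Rightarrow> real) set).
           \<forall>x\<in>upper_half. \<forall>y\<in>upper_half.
             \<bar>u x - u y\<bar> \<le> C * Theta0 (1 - n / p) (1 - (n + \<gamma>) / p) x y *
               (\<integral>z\<in>upper_half. onorm (frechet_derivative u (at z)) powr p * snd z powr \<gamma> \<partial>lborel) powr (1 / p)"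
proof -
  define \<beta> where "\<beta> = 1 - n / p"
  define \<kappa> where "\<kappa> = 1 - (n + \<gamma>) / p"
  have n: "n \<ge> 2"
  proof -
    have "CARD('m) > 0" by simp
    then show ?thesis unfolding n_def by linarith
  qed
  have \<beta>: "\<beta> \<ge> 0"
    using assms(2) n by (simp add: \<beta>_def)
  have "\<gamma> < p - 1 \<or> \<gamma> > p - n"
    using n by linarith
  then have "\<exists>C>0. \<forall>u \<in> (Cc_inf_half :: ((real^'m) \<times> real \<Rightarrow> real) set). \<forall>x\<in>upper_half.
    \<bar>u x\<bar> \<le> C * snd x powr \<kappa> * weighted_energy p \<gamma> u powr (1 / p)"
    using sup_estimate_down[where 'm = 'm, of p \<gamma>] sup_estimate_up[where 'm = 'm, of p \<gamma>] assms(2)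
    by (auto simp: n_def \<kappa>_def)
  then obtain C1 where C1: "C1 > 0" and global:
    "\<And>(u :: (real^'m) \<times> real \<Rightarrow> real) x. u \<in> Cc_inf_half \<Longrightarrow> x \<in> upper_half \<Longrightarrow>
      \<bar>u x\<bar> \<le> C1 * snd x powr \<kappa> * weighted_energy p \<gamma> u powr (1 / p)"
    by blast
  obtain C2 where C2: "C2 > 0" and local:
    "\<And>(u :: (real^'m) \<times> real \<Rightarrow> real) x y. u \<in> Cc_inf_half \<Longrightarrow> x \<in> upper_half \<Longrightarrow> y \<in> upper_half \<Longrightarrow>
      2 * dist x y \<le> max (snd x) (snd y) \<Longrightarrow>
      \<bar>u x - u y\<bar> \<le> C2 * dist x y powr \<beta> * max (snd x) (snd y) powr - (\<gamma> / p)
        * weighted_energy p \<gamma> u powr (1 / p)"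
    using local_estimate[where 'm = 'm, of p \<gamma>] assms(2) unfolding n_def \<beta>_def by blast
  \<comment> \<open>Far points need two single-value bounds, each with a loss of
    \<open>2 powr \<beta>\<close>; near points need \<open>C2\<close>. Both contributions are
    nonnegative, so the sum serves either regime.\<close>
  define C where "C = 2 * C1 * 2 powr \<beta> + C2"
  show ?thesis
    unfolding weighted_energy_def[symmetric] \<beta>_def[symmetric] \<kappa>_def[symmetric]
  proof (intro exI[of _ C] conjI ballI)
    show "C > 0"
      using C1 C2 by (simp add: C_def add_pos_pos)
    fix u :: "(real^'m) \<times> real \<Rightarrow> real" and x y :: "(real^'m) \<times> real"
    assume u: "u \<in> Cc_inf_half" and xy: "x \<in> upper_half" "y \<in> upper_half"
    let ?N = "weighted_energy p \<gamma> u powr (1 / p)" and ?\<Theta> = "Theta0 \<beta> \<kappa> x y"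
    have pos: "snd x > 0" "snd y > 0"
      using xy by (auto simp: upper_half_def)
    have \<Theta>: "?\<Theta> \<ge> 0"
      by (simp add: Theta0_def)
    have "\<bar>u x - u y\<bar> \<le> 2 * C1 * 2 powr \<beta> * ?\<Theta> * ?N \<or> \<bar>u x - u y\<bar> \<le> C2 * ?\<Theta> * ?N"
    proof (cases "2 * dist x y \<le> max (snd x) (snd y)")
      case True
      \<comment> \<open>This identity matches the height exponent of the local bound with that of
        \<open>Theta0_ge_near\<close>.\<close>
      have "\<kappa> - \<beta> = - (\<gamma> / p)"
        by (simp add: \<kappa>_def \<beta>_def add_divide_distrib)
      then have "C2 * (dist x y powr \<beta> * max (snd x) (snd y) powr - (\<gamma> / p)) * ?N \<le> C2 * ?\<Theta> * ?N"
        using Theta0_ge_near[OF pos True, of \<beta> \<kappa>] C2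
        by (intro mult_right_mono mult_left_mono) auto
      then show ?thesis
        using local[OF u xy True] by (simp add: mult.assoc)
    next
      case False
      then have far: "max (snd x) (snd y) \<le> 2 * dist x y"
        by linarith
      have bound: "\<bar>u a\<bar> \<le> C1 * (2 powr \<beta> * ?\<Theta>) * ?N" if a: "a = x \<or> a = y" for a
      proof -
        have "\<bar>u a\<bar> \<le> C1 * snd a powr \<kappa> * ?N"
          using a xy by (intro global[OF u]) auto
        also have "\<dots> \<le> C1 * (2 powr \<beta> * ?\<Theta>) * ?N"
          using Theta0_ge_far[OF pos \<beta> far, of "snd a" \<kappa>] C1 a
          by (intro mult_right_mono mult_left_mono) auto
        finally show ?thesis .
      qed
      have "\<bar>u x - u y\<bar> \<le> C1 * (2 powr \<beta> * ?\<Theta>) * ?N + C1 * (2 powr \<beta> * ?\<Theta>) * ?N"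
        using bound[OF disjI1[OF refl]] bound[OF disjI2[OF refl]] by linarith
      then show ?thesis by (simp add: mult_ac)
    qed
    moreover have "2 * C1 * 2 powr \<beta> * ?\<Theta> * ?N \<ge> 0" "C2 * ?\<Theta> * ?N \<ge> 0"
      using C1 C2 \<Theta> by auto
    ultimately show "\<bar>u x - u y\<bar> \<le> C * ?\<Theta> * ?N"
      unfolding C_def distrib_right by linarith
  qed
qed

end
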